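(* Consider the discrete pricing problem $$\max_{\bm{x}} N(\bm{x})\quad\text{s.t.}\quad \frac{N(\bm{x})}{D(\bm{x})}\ge \Delta,\qquad x_i\in\mathcal X_i,\quad \frac{|x_i-a_i|}{a_i}\le\sigma_i\quad(i=1,\dots,n),$$ and the multiple-choice knapsack problem (MCKP) $$\max_{z}\ \sum_{i=1}^n\sum_{j\in J_i^{\mathrm{ad}}} v_{ij}z_{ij}\quad\text{s.t.}\quad \sum_{i=1}^n\sum_{j\in J_i^{\mathrm{ad}}} c_{ij}z_{ij}\le S_{\max},\quad \sum_{j\in J_i^{\mathrm{ad}}} z_{ij}=1\ (i=1,\dots,n),\quad z_{ij}\in\{0,1\}\ (\forall i,\ j\in J_i^{\mathrm{ad}}).$$ All costs $c_{ij}$ are nonnegative, and the pricing problem is exactly this MCKP: under the correspondence $z_{ij}=1\iff x_i=x_{i,j}$ between price vectors satisfying $x_i\in\mathcal X_i$, $|x_i-a_i|/a_i\le\sigma_i$ for all $i$ and binary vectors $z$ satisfying $\sum_{j\in J_i^{\mathrm{ad}}}z_{ij}=1$ for all $i$, the ratio constraint $N(\bm{x})/D(\bm{x})\ge\Delta$ holds if and only if $\sum_{i}\sum_{j\in J_i^{\mathrm{ad}}}c_{ij}z_{ij}\le S_{\max}$, and $N(\bm{x})=\sum_i\sum_{j\in J_i^{\mathrm{ad}}}v_{ij}z_{ij}$.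
   Context: Data. There are items $i=1,\dots,n$. Item $i$ has a finite price menu $\mathcal X_i=\{x_{i,1},\dots,x_{i,m}\}\subset\mathbb R$ of distinct prices, a reference price $a_i>0$, an exposure $\omega_i>0$, a nominal demand function $\hat g_i:\mathcal X_i\to\mathbb R_{>0}$ (monotone decreasing on the admissible range), and a relative tolerance $\sigma_i$. A margin target $\Delta>0$ is given. Define, for a price vector $\bm{x}=(x_1,\dots,x_n)$, $$N(\bm{x})=\sum_{i=1}^n\omega_i x_i\hat g_i(x_i),\qquad D(\bm{x})=\sum_{i=1}^n\omega_i a_i\hat g_i(x_i)>0.$$ The admissible menu is $\mathcal X_i^{\mathrm{ad}}=\mathcal X_i\cap[(1-\sigma_i)a_i,(1+\sigma_i)a_i]$, assumed nonempty for every $i$, and $J_i^{\mathrm{ad}}=\{j: x_{i,j}\in\mathcal X_i^{\mathrm{ad}}\}$. For each option define $v_{ij}=\omega_i x_{i,j}\hat g_i(x_{i,j})$, $d_{ij}=\omega_i a_i\hat g_i(x_{i,j})$, $s_{ij}=v_{ij}-\Delta d_{ij}$. For each $i$ choose a baseline $j^*(i)\in\arg\max_{j\in J_i^{\mathrm{ad}}}s_{ij}$, and set $S_{\max}=\sum_{i=1}^n s_{i\,j^*(i)}$ and $c_{ij}=s_{i\,j^*(i)}-s_{ij}$ for $j\in J_i^{\mathrm{ad}}$. *)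

theory Defs
  imports Complex_Main "HOL-Library.FuncSet"
begin

record pricing_data =
  num_items :: nat
  menu_size :: nat
  price :: "nat \<Rightarrow> nat \<Rightarrow> real"
  ref_price :: "nat \<Rightarrow> real"
  exposure :: "nat \<Rightarrow> real"
  demand :: "nat \<Rightarrow> real \<Rightarrow> real"
  tolerance :: "nat \<Rightarrow> real"
  margin_target :: real

definition items :: "pricing_data \<Rightarrow> nat set" where
  "items P = {1..num_items P}"

definition menu :: "pricing_data \<Rightarrow> nat \<Rightarrow> real set" where
  "menu P i = price P i ` {1..menu_size P}"

definition adm_menu :: "pricing_data \<Rightarrow> nat \<Rightarrow> real set" where
  "adm_menu P i = menu P i \<inter>
     {(1 - tolerance P i) * ref_price P i .. (1 + tolerance P i) * ref_price P i}"

definition adm_index :: "pricing_data \<Rightarrow> nat \<Rightarrow> nat set" where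
  "adm_index P i = {j \<in> {1..menu_size P}. price P i j \<in> adm_menu P i}"

definition N :: "pricing_data \<Rightarrow> (nat \<Rightarrow> real) \<Rightarrow> real" where
  "N P x = (\<Sum>i\<in>items P. exposure P i * x i * demand P i (x i))"

definition D :: "pricing_data \<Rightarrow> (nat \<Rightarrow> real) \<Rightarrow> real" where
  "D P x = (\<Sum>i\<in>items P. exposure P i * ref_price P i * demand P i (x i))"

definition v :: "pricing_data \<Rightarrow> nat \<Rightarrow> nat \<Rightarrow> real" where
  "v P i j = exposure P i * price P i j * demand P i (price P i j)"

definition d :: "pricing_data \<Rightarrow> nat \<Rightarrow> nat \<Rightarrow> real" where
  "d P i j = exposure P i * ref_price P i * demand P i (price P i j)"

definition s :: "pricing_data \<Rightarrow> nat \<Rightarrow> nat \<Rightarrow> real" where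
  "s P i j = v P i j - margin_target P * d P i j"

definition is_baseline :: "pricing_data \<Rightarrow> (nat \<Rightarrow> nat) \<Rightarrow> bool" where
  "is_baseline P b \<longleftrightarrow>
     (\<forall>i\<in>items P. is_arg_max (s P i) (\<lambda>j. j \<in> adm_index P i) (b i))"

definition S_max :: "pricing_data \<Rightarrow> (nat \<Rightarrow> nat) \<Rightarrow> real" where
  "S_max P b = (\<Sum>i\<in>items P. s P i (b i))"

definition c :: "pricing_data \<Rightarrow> (nat \<Rightarrow> nat) \<Rightarrow> nat \<Rightarrow> nat \<Rightarrow> real" where
  "c P b i j = s P i (b i) - s P i j"

text \<open>Price vectors and selection vectors are extensional functions
  (\<^const>\<open>undefined\<close> outside the index set), so that each mathematical vector is
  represented by exactly one function.\<close>

definition price_vectors :: "pricing_data \<Rightarrow> (nat \<Rightarrow> real) set" where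
  "price_vectors P = {x \<in> (\<Pi>\<^sub>E i\<in>items P. menu P i).
     \<forall>i\<in>items P. \<bar>x i - ref_price P i\<bar> / ref_price P i \<le> tolerance P i}"

definition selections :: "pricing_data \<Rightarrow> (nat \<Rightarrow> nat \<Rightarrow> real) set" where
  "selections P = {z \<in> (\<Pi>\<^sub>E i\<in>items P. \<Pi>\<^sub>E j\<in>adm_index P i. {0, 1}).
     \<forall>i\<in>items P. (\<Sum>j\<in>adm_index P i. z i j) = 1}"

definition pricing_feasible :: "pricing_data \<Rightarrow> (nat \<Rightarrow> real) \<Rightarrow> bool" where
  "pricing_feasible P x \<longleftrightarrow> x \<in> price_vectors P \<and> N P x / D P x \<ge> margin_target P"

definition mckp_value :: "pricing_data \<Rightarrow> (nat \<Rightarrow> nat \<Rightarrow> real) \<Rightarrow> real" where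
  "mckp_value P z = (\<Sum>i\<in>items P. \<Sum>j\<in>adm_index P i. v P i j * z i j)"

definition mckp_cost ::
    "pricing_data \<Rightarrow> (nat \<Rightarrow> nat) \<Rightarrow> (nat \<Rightarrow> nat \<Rightarrow> real) \<Rightarrow> real" where
  "mckp_cost P b z = (\<Sum>i\<in>items P. \<Sum>j\<in>adm_index P i. c P b i j * z i j)"

definition mckp_feasible ::
    "pricing_data \<Rightarrow> (nat \<Rightarrow> nat) \<Rightarrow> (nat \<Rightarrow> nat \<Rightarrow> real) \<Rightarrow> bool" where
  "mckp_feasible P b z \<longleftrightarrow> z \<in> selections P \<and> mckp_cost P b z \<le> S_max P b"

definition corresponds ::
    "pricing_data \<Rightarrow> (nat \<Rightarrow> real) \<Rightarrow> (nat \<Rightarrow> nat \<Rightarrow> real) \<Rightarrow> bool" where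
  "corresponds P x z \<longleftrightarrow>
     (\<forall>i\<in>items P. \<forall>j\<in>adm_index P i. z i j = 1 \<longleftrightarrow> x i = price P i j)"

end

theory Submission
  imports Defs
begin

text \<open>
  Both feasible sets are encodings of one and the same object: a choice of one admissible option
  \<open>k i\<close> for every item. The tolerance condition says exactly that \<open>x i\<close> is the price of an
  admissible option (\<open>price_vectors_eq\<close>), and a binary row with sum one is the indicator of a single
  option (\<open>binary_sum_eq_1_iff\<close>). Because the prices in a menu are distinct, a price vector and a
  selection correspond precisely when they encode the same choice (\<open>corresponds_imp_choice\<close>); this
  gives the bijection in both directions.

  Along a common choice every double sum over a selection collapses to \<open>\<Sum>i. f i (k i)\<close>
  (\<open>sum_selection\<close>). Hence the two objectives agree, and the cost of a selection is
  \<open>S_max - (N x - \<Delta> * D x)\<close>, the amount by which its total margin surplus falls short of the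
  baseline surplus. Since \<open>D x > 0\<close>, the ratio constraint is the linear inequality
  \<open>N x - \<Delta> * D x \<ge> 0\<close>, which is therefore the budget constraint. Equivalence of optimality is the
  general fact that a correspondence, total on both sides, which preserves feasibility and the
  objective also preserves maximisers (\<open>is_arg_max_transfer\<close>).
\<close>

section \<open>Maximisers and indicator vectors\<close>

lemma is_arg_max_transfer:
  fixes f :: "'a \<Rightarrow> 'c::order" and g :: "'b \<Rightarrow> 'c"
  assumes R: "\<And>x z. R x z \<Longrightarrow> (F x \<longleftrightarrow> G z) \<and> f x = g z"
    and left: "\<And>x. F x \<Longrightarrow> \<exists>z. R x z"
    and right: "\<And>z. G z \<Longrightarrow> \<exists>x. R x z"
    and xz: "R x z"
  shows "is_arg_max f F x \<longleftrightarrow> is_arg_max g G z"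
  unfolding is_arg_max_def using R[OF xz] by (metis R left right)

lemma binary_sum_eq_1_iff:
  fixes z :: "'a \<Rightarrow> real"
  assumes "finite A" and bin: "\<And>j. j \<in> A \<Longrightarrow> z j \<in> {0, 1}"
  shows "sum z A = 1 \<longleftrightarrow> (\<exists>k\<in>A. \<forall>j\<in>A. z j = (if j = k then 1 else 0))"
proof -
  have "sum z A = (\<Sum>j\<in>A. if z j = 1 then 1 else 0)"
    using bin by (intro sum.cong) auto
  also have "\<dots> = real (card {j \<in> A. z j = 1})"
    using \<open>finite A\<close> by (simp add: sum.If_cases Int_def)
  finally have "sum z A = 1 \<longleftrightarrow> (\<exists>k. {j \<in> A. z j = 1} = {k})"
    by (simp add: card_1_singleton_iff)
  also have "\<dots> \<longleftrightarrow> (\<exists>k\<in>A. \<forall>j\<in>A. z j = (if j = k then 1 else 0))"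
  proof -
    have "{j \<in> A. z j = 1} = {k} \<longleftrightarrow> k \<in> A \<and> (\<forall>j\<in>A. z j = 1 \<longleftrightarrow> j = k)" for k
      by blast
    moreover have "(z j = 1 \<longleftrightarrow> j = k) \<longleftrightarrow> z j = (if j = k then 1 else 0)" if "j \<in> A" for j k
      using bin[OF that] by auto
    ultimately show ?thesis by (simp add: Bex_def)
  qed
  finally show ?thesis .
qed

section \<open>Price vectors and selections as choices of options\<close>

lemma finite_adm_index [simp]: "finite (adm_index P i)"
  by (simp add: adm_index_def)

lemma adm_menu_eq_image: "adm_menu P i = price P i ` adm_index P i"
  by (auto simp: adm_index_def adm_menu_def menu_def)

text \<open>Multiplying the relative deviation bound by the positive reference price turns it into the
  interval that cuts the admissible menu out of the menu.\<close>

lemma price_vectors_eq: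
  assumes "\<And>i. i \<in> items P \<Longrightarrow> ref_price P i > 0"
  shows "price_vectors P = (\<Pi>\<^sub>E i\<in>items P. price P i ` adm_index P i)"
proof -
  have "y \<in> menu P i \<and> \<bar>y - ref_price P i\<bar> / ref_price P i \<le> tolerance P i \<longleftrightarrow> y \<in> adm_menu P i"
    if "i \<in> items P" for i y
    using assms[OF that] by (auto simp: adm_menu_def pos_divide_le_eq abs_le_iff algebra_simps)
  then have "x \<in> price_vectors P \<longleftrightarrow> x \<in> (\<Pi>\<^sub>E i\<in>items P. adm_menu P i)" for x
    unfolding price_vectors_def PiE_iff by blast
  then show ?thesis
    by (auto simp: adm_menu_eq_image)
qed

lemma selections_iff:
  "z \<in> selections P \<longleftrightarrow> z \<in> extensional (items P) \<and>
     (\<forall>i\<in>items P. z i \<in> extensional (adm_index P i) \<and>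
        (\<exists>k\<in>adm_index P i. \<forall>j\<in>adm_index P i. z i j = (if j = k then 1 else 0)))"
  (is "_ \<longleftrightarrow> ?R")
proof
  assume z: "z \<in> selections P"
  have "\<exists>k\<in>adm_index P i. \<forall>j\<in>adm_index P i. z i j = (if j = k then 1 else 0)" if "i \<in> items P" for i
    using z that binary_sum_eq_1_iff[of "adm_index P i" "z i"] unfolding selections_def PiE_iff by auto
  then show ?R
    using z unfolding selections_def PiE_iff by blast
next
  assume R: ?R
  have bin: "z i j \<in> {0, 1}" if "i \<in> items P" "j \<in> adm_index P i" for i j
  proof -
    obtain k where "z i j = (if j = k then 1 else 0)"
      using R \<open>i \<in> items P\<close> \<open>j \<in> adm_index P i\<close> by blast
    then show ?thesis by simp
  qed
  have "sum (z i) (adm_index P i) = 1" if "i \<in> items P" for i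
    using R that bin by (subst binary_sum_eq_1_iff) auto
  then show "z \<in> selections P"
    using R bin by (auto simp: selections_def PiE_iff)
qed

definition choice_prices :: "pricing_data \<Rightarrow> (nat \<Rightarrow> nat) \<Rightarrow> nat \<Rightarrow> real" where
  "choice_prices P k = (\<lambda>i\<in>items P. price P i (k i))"

definition choice_selection :: "pricing_data \<Rightarrow> (nat \<Rightarrow> nat) \<Rightarrow> nat \<Rightarrow> nat \<Rightarrow> real" where
  "choice_selection P k = (\<lambda>i\<in>items P. \<lambda>j\<in>adm_index P i. if j = k i then 1 else 0)"

lemma price_vectorsE:
  assumes "\<And>i. i \<in> items P \<Longrightarrow> ref_price P i > 0" and "x \<in> price_vectors P"
  obtains k where "\<And>i. i \<in> items P \<Longrightarrow> k i \<in> adm_index P i" and "x = choice_prices P k"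
proof -
  have x: "x \<in> (\<Pi>\<^sub>E i\<in>items P. price P i ` adm_index P i)"
    using assms price_vectors_eq by blast
  then have "\<forall>i\<in>items P. \<exists>k. k \<in> adm_index P i \<and> x i = price P i k"
    by (auto simp: PiE_iff)
  then obtain k where k: "\<forall>i\<in>items P. k i \<in> adm_index P i \<and> x i = price P i (k i)"
    by metis
  have "x = choice_prices P k"
    using k x unfolding choice_prices_def
    by (intro extensionalityI[of _ "items P"]) (auto simp: PiE_iff)
  with k that show thesis by blast
qed

lemma selectionsE:
  assumes "z \<in> selections P"
  obtains k where "\<And>i. i \<in> items P \<Longrightarrow> k i \<in> adm_index P i" and "z = choice_selection P k"
proof -
  have "\<forall>i\<in>items P. \<exists>k. k \<in> adm_index P i \<and> (\<forall>j\<in>adm_index P i. z i j = (if j = k then 1 else 0))"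
    using assms unfolding selections_iff by blast
  then obtain k where k: "\<forall>i\<in>items P. k i \<in> adm_index P i \<and>
      (\<forall>j\<in>adm_index P i. z i j = (if j = k i then 1 else 0))"
    by metis
  have row: "z i = (\<lambda>j\<in>adm_index P i. if j = k i then 1 else 0)" if "i \<in> items P" for i
    using k that assms unfolding selections_iff
    by (intro extensionalityI[of _ "adm_index P i"]) auto
  have "z = choice_selection P k"
  proof (rule extensionalityI)
    show "z \<in> extensional (items P)"
      using assms unfolding selections_iff by blast
  qed (simp_all add: choice_selection_def row)
  with k that show thesis by blast
qed

lemma choice_prices_in_price_vectors:
  assumes "\<And>i. i \<in> items P \<Longrightarrow> ref_price P i > 0"
    and "\<And>i. i \<in> items P \<Longrightarrow> k i \<in> adm_index P i"
  shows "choice_prices P k \<in> price_vectors P"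
proof -
  have "choice_prices P k \<in> (\<Pi>\<^sub>E i\<in>items P. price P i ` adm_index P i)"
    using assms(2) by (auto simp: choice_prices_def)
  then show ?thesis
    using price_vectors_eq[OF assms(1)] by blast
qed

lemma choice_selection_in_selections:
  assumes "\<And>i. i \<in> items P \<Longrightarrow> k i \<in> adm_index P i"
  shows "choice_selection P k \<in> selections P"
  using assms unfolding selections_iff choice_selection_def by auto

section \<open>The correspondence is a bijection\<close>

lemma corresponds_choice_iff:
  assumes inj: "\<And>i. i \<in> items P \<Longrightarrow> inj_on (price P i) {1..menu_size P}"
    and k: "\<And>i. i \<in> items P \<Longrightarrow> k i \<in> adm_index P i"
    and l: "\<And>i. i \<in> items P \<Longrightarrow> l i \<in> adm_index P i"
  shows "corresponds P (choice_prices P k) (choice_selection P l) \<longleftrightarrow> (\<forall>i\<in>items P. k i = l i)"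
proof -
  have "price P i (k i) = price P i j \<longleftrightarrow> k i = j" if "i \<in> items P" "j \<in> adm_index P i" for i j
    using inj_on_eq_iff[OF inj[OF that(1)]] k[OF that(1)] that(2) by (simp add: adm_index_def)
  then have "corresponds P (choice_prices P k) (choice_selection P l) \<longleftrightarrow>
      (\<forall>i\<in>items P. \<forall>j\<in>adm_index P i. j = l i \<longleftrightarrow> k i = j)"
    by (auto simp: corresponds_def choice_prices_def choice_selection_def)
  then show ?thesis
    using l by metis
qed

lemma choice_prices_cong: "(\<And>i. i \<in> items P \<Longrightarrow> k i = l i) \<Longrightarrow> choice_prices P k = choice_prices P l"
  by (auto simp: choice_prices_def restrict_def)

lemma choice_selection_cong:
  "(\<And>i. i \<in> items P \<Longrightarrow> k i = l i) \<Longrightarrow> choice_selection P k = choice_selection P l"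
  by (auto simp: choice_selection_def restrict_def fun_eq_iff)

text \<open>Two choices with equal values on the items have equal encodings, so \<open>corresponds_choice_iff\<close>
  lets one choice function serve both members of a corresponding pair.\<close>

lemma corresponds_imp_choice:
  assumes inj: "\<And>i. i \<in> items P \<Longrightarrow> inj_on (price P i) {1..menu_size P}"
    and ref: "\<And>i. i \<in> items P \<Longrightarrow> ref_price P i > 0"
    and "x \<in> price_vectors P" "z \<in> selections P" "corresponds P x z"
  obtains k where "\<And>i. i \<in> items P \<Longrightarrow> k i \<in> adm_index P i"
    and "x = choice_prices P k" and "z = choice_selection P k"
proof -
  obtain k where k: "\<And>i. i \<in> items P \<Longrightarrow> k i \<in> adm_index P i" "x = choice_prices P k"
    using price_vectorsE[OF ref \<open>x \<in> price_vectors P\<close>] by blast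
  obtain l where l: "\<And>i. i \<in> items P \<Longrightarrow> l i \<in> adm_index P i" "z = choice_selection P l"
    using selectionsE[OF \<open>z \<in> selections P\<close>] by blast
  have "\<forall>i\<in>items P. k i = l i"
    using \<open>corresponds P x z\<close> corresponds_choice_iff[OF inj k(1) l(1)] k(2) l(2) by simp
  then have "z = choice_selection P k"
    using choice_selection_cong l(2) by metis
  with k that show thesis by blast
qed

lemma ex1_corresponding_selection:
  assumes inj: "\<And>i. i \<in> items P \<Longrightarrow> inj_on (price P i) {1..menu_size P}"
    and ref: "\<And>i. i \<in> items P \<Longrightarrow> ref_price P i > 0"
    and "x \<in> price_vectors P"
  shows "\<exists>!z. z \<in> selections P \<and> corresponds P x z"
proof -
  obtain k where k: "\<And>i. i \<in> items P \<Longrightarrow> k i \<in> adm_index P i" and x: "x = choice_prices P k"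
    using price_vectorsE[OF ref \<open>x \<in> price_vectors P\<close>] by blast
  show ?thesis
  proof (rule ex1I[of _ "choice_selection P k"])
    show "choice_selection P k \<in> selections P \<and> corresponds P x (choice_selection P k)"
      using choice_selection_in_selections[OF k] corresponds_choice_iff[OF inj k k] x by simp
  next
    fix z assume z: "z \<in> selections P \<and> corresponds P x z"
    then obtain l where l: "\<And>i. i \<in> items P \<Longrightarrow> l i \<in> adm_index P i" "z = choice_selection P l"
      using selectionsE by blast
    then have "\<forall>i\<in>items P. l i = k i"
      using z corresponds_choice_iff[OF inj k l(1)] x by simp
    then show "z = choice_selection P k"
      using choice_selection_cong l(2) by metis
  qed
qed

lemma ex1_corresponding_price_vector:
  assumes inj: "\<And>i. i \<in> items P \<Longrightarrow> inj_on (price P i) {1..menu_size P}"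
    and ref: "\<And>i. i \<in> items P \<Longrightarrow> ref_price P i > 0"
    and "z \<in> selections P"
  shows "\<exists>!x. x \<in> price_vectors P \<and> corresponds P x z"
proof -
  obtain k where k: "\<And>i. i \<in> items P \<Longrightarrow> k i \<in> adm_index P i" and z: "z = choice_selection P k"
    using selectionsE[OF \<open>z \<in> selections P\<close>] by blast
  show ?thesis
  proof (rule ex1I[of _ "choice_prices P k"])
    show "choice_prices P k \<in> price_vectors P \<and> corresponds P (choice_prices P k) z"
      using choice_prices_in_price_vectors[OF ref k] corresponds_choice_iff[OF inj k k] z by simp
  next
    fix x assume x: "x \<in> price_vectors P \<and> corresponds P x z"
    then obtain l where l: "\<And>i. i \<in> items P \<Longrightarrow> l i \<in> adm_index P i" "x = choice_prices P l"
      using price_vectorsE[OF ref] by blast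
    then have "\<forall>i\<in>items P. l i = k i"
      using x corresponds_choice_iff[OF inj l(1) k] z by simp
    then show "x = choice_prices P k"
      using choice_prices_cong l(2) by metis
  qed
qed

section \<open>Objective, cost and ratio constraint\<close>

lemma sum_selection:
  assumes "\<And>i. i \<in> items P \<Longrightarrow> k i \<in> adm_index P i"
  shows "(\<Sum>i\<in>items P. \<Sum>j\<in>adm_index P i. f i j * choice_selection P k i j) =
    (\<Sum>i\<in>items P. f i (k i))"
proof (rule sum.cong)
  fix i assume i: "i \<in> items P"
  have "(\<Sum>j\<in>adm_index P i. f i j * choice_selection P k i j) =
      (\<Sum>j\<in>adm_index P i. if j = k i then f i j else 0)"
    using i by (intro sum.cong) (auto simp: choice_selection_def)
  also have "\<dots> = f i (k i)"
    using assms[OF i] by simp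
  finally show "(\<Sum>j\<in>adm_index P i. f i j * choice_selection P k i j) = f i (k i)" .
qed simp

lemma N_choice_prices: "N P (choice_prices P k) = (\<Sum>i\<in>items P. v P i (k i))"
  by (simp add: N_def v_def choice_prices_def)

lemma D_choice_prices: "D P (choice_prices P k) = (\<Sum>i\<in>items P. d P i (k i))"
  by (simp add: D_def d_def choice_prices_def)

lemma mckp_value_choice:
  assumes "\<And>i. i \<in> items P \<Longrightarrow> k i \<in> adm_index P i"
  shows "mckp_value P (choice_selection P k) = N P (choice_prices P k)"
  by (simp add: mckp_value_def N_choice_prices sum_selection[OF assms])

text \<open>The baseline terms of the costs sum to \<open>S_max\<close> whatever the choice, so the budget constraint
  is nonnegativity of the bracket on the right-hand side.\<close>

lemma mckp_cost_choice:
  assumes "\<And>i. i \<in> items P \<Longrightarrow> k i \<in> adm_index P i"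
  shows "mckp_cost P b (choice_selection P k) =
    S_max P b - (N P (choice_prices P k) - margin_target P * D P (choice_prices P k))"
proof -
  have "mckp_cost P b (choice_selection P k) = (\<Sum>i\<in>items P. c P b i (k i))"
    by (simp add: mckp_cost_def sum_selection[OF assms])
  also have "\<dots> = S_max P b - (\<Sum>i\<in>items P. s P i (k i))"
    by (simp add: c_def S_max_def sum_subtractf)
  also have "(\<Sum>i\<in>items P. s P i (k i)) =
      N P (choice_prices P k) - margin_target P * D P (choice_prices P k)"
    by (simp add: s_def sum_subtractf sum_distrib_left N_choice_prices D_choice_prices)
  finally show ?thesis .
qed

lemma D_pos:
  assumes "num_items P \<ge> 1"
    and "\<And>i. i \<in> items P \<Longrightarrow> ref_price P i > 0"
    and "\<And>i. i \<in> items P \<Longrightarrow> exposure P i > 0"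
    and "\<And>i y. i \<in> items P \<Longrightarrow> y \<in> menu P i \<Longrightarrow> demand P i y > 0"
    and "x \<in> price_vectors P"
  shows "D P x > 0"
  unfolding D_def
proof (rule sum_pos)
  show "finite (items P)" "items P \<noteq> {}"
    using assms(1) by (auto simp: items_def)
  fix i assume i: "i \<in> items P"
  then have "x i \<in> menu P i"
    using assms(5) by (auto simp: price_vectors_def PiE_iff)
  then show "exposure P i * ref_price P i * demand P i (x i) > 0"
    using i assms(2-4) by simp
qed

lemma baseline_cost_nonneg:
  assumes "is_baseline P b" "i \<in> items P" "j \<in> adm_index P i"
  shows "c P b i j \<ge> 0"
  using assms by (auto simp: c_def is_baseline_def is_arg_max_linorder)

section \<open>Equivalence of the two problems\<close>

theorem mainTheorem1:
  fixes P :: pricing_data and b :: "nat \<Rightarrow> nat"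
  assumes "num_items P \<ge> 1"
    and "\<And>i. i \<in> items P \<Longrightarrow> inj_on (price P i) {1..menu_size P}"
    and "\<And>i. i \<in> items P \<Longrightarrow> ref_price P i > 0"
    and "\<And>i. i \<in> items P \<Longrightarrow> exposure P i > 0"
    and "\<And>i y. i \<in> items P \<Longrightarrow> y \<in> menu P i \<Longrightarrow> demand P i y > 0"
    and "\<And>i. i \<in> items P \<Longrightarrow> antimono_on (adm_menu P i) (demand P i)"
    and "margin_target P > 0"
    and "\<And>i. i \<in> items P \<Longrightarrow> adm_menu P i \<noteq> {}"
    and "is_baseline P b"
  shows "(\<forall>i\<in>items P. \<forall>j\<in>adm_index P i. c P b i j \<ge> 0)
    \<and> (\<forall>x\<in>price_vectors P. \<exists>!z. z \<in> selections P \<and> corresponds P x z)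
    \<and> (\<forall>z\<in>selections P. \<exists>!x. x \<in> price_vectors P \<and> corresponds P x z)
    \<and> (\<forall>x\<in>price_vectors P. \<forall>z\<in>selections P. corresponds P x z \<longrightarrow>
          (N P x / D P x \<ge> margin_target P \<longleftrightarrow> mckp_cost P b z \<le> S_max P b)
        \<and> N P x = mckp_value P z
        \<and> (pricing_feasible P x \<longleftrightarrow> mckp_feasible P b z)
        \<and> (is_arg_max (N P) (pricing_feasible P) x \<longleftrightarrow>
             is_arg_max (mckp_value P) (mckp_feasible P b) z))"
proof -
  have pair: "(N P x / D P x \<ge> margin_target P \<longleftrightarrow> mckp_cost P b z \<le> S_max P b) \<and>
      N P x = mckp_value P z"
    if x: "x \<in> price_vectors P" and z: "z \<in> selections P" and xz: "corresponds P x z" for x z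
  proof -
    obtain k where k: "\<And>i. i \<in> items P \<Longrightarrow> k i \<in> adm_index P i"
      and xk: "x = choice_prices P k" and zk: "z = choice_selection P k"
      using corresponds_imp_choice[OF assms(2,3) x z xz] by blast
    have "D P x > 0"
      using D_pos[OF assms(1,3,4,5) x] .
    then have "N P x / D P x \<ge> margin_target P \<longleftrightarrow> N P x - margin_target P * D P x \<ge> 0"
      by (simp add: pos_le_divide_eq)
    also have "\<dots> \<longleftrightarrow> mckp_cost P b z \<le> S_max P b"
      by (simp add: mckp_cost_choice[OF k] xk zk)
    finally show ?thesis
      by (simp add: mckp_value_choice[OF k] xk zk)
  qed
  have sel: "\<exists>!z. z \<in> selections P \<and> corresponds P x z" if "x \<in> price_vectors P" for x
    using ex1_corresponding_selection[OF assms(2,3) that] .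
  have vec: "\<exists>!x. x \<in> price_vectors P \<and> corresponds P x z" if "z \<in> selections P" for z
    using ex1_corresponding_price_vector[OF assms(2,3) that] .
  \<comment> \<open>Membership is part of the relation so that it can serve as a correspondence on whole types.\<close>
  define R where "R x z \<longleftrightarrow> x \<in> price_vectors P \<and> z \<in> selections P \<and> corresponds P x z" for x z
  have R: "(pricing_feasible P x \<longleftrightarrow> mckp_feasible P b z) \<and> N P x = mckp_value P z" if "R x z" for x z
    using that pair[of x z] by (auto simp: R_def pricing_feasible_def mckp_feasible_def)
  have left: "\<exists>z. R x z" if "pricing_feasible P x" for x
    using that ex1_implies_ex[OF sel[of x]] by (auto simp: R_def pricing_feasible_def)
  have right: "\<exists>x. R x z" if "mckp_feasible P b z" for z
    using that ex1_implies_ex[OF vec[of z]] by (auto simp: R_def mckp_feasible_def)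
  have opt: "is_arg_max (N P) (pricing_feasible P) x \<longleftrightarrow>
      is_arg_max (mckp_value P) (mckp_feasible P b) z" if "R x z" for x z
  proof (rule is_arg_max_transfer)
    show "R x z" by fact
  qed (fact R left right)+
  show ?thesis
  proof (intro conjI ballI impI)
    fix i j assume "i \<in> items P" "j \<in> adm_index P i"
    then show "c P b i j \<ge> 0"
      using baseline_cost_nonneg[OF assms(9)] by blast
  next
    fix x z assume "x \<in> price_vectors P" "z \<in> selections P" "corresponds P x z"
    then have xz: "R x z"
      by (simp add: R_def)
    show "N P x / D P x \<ge> margin_target P \<longleftrightarrow> mckp_cost P b z \<le> S_max P b"
      "N P x = mckp_value P z"
      using pair xz by (auto simp: R_def)
    show "pricing_feasible P x \<longleftrightarrow> mckp_feasible P b z"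
      using R[OF xz] by blast
    show "is_arg_max (N P) (pricing_feasible P) x \<longleftrightarrow>
        is_arg_max (mckp_value P) (mckp_feasible P b) z"
      using opt[OF xz] .
  qed (use sel vec in auto)
qed

end
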